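(* Let $I\subset(0,1)$ and $H\subset\mathbb{R}$ be compact. As $r\to\infty$ ($r$ real), uniformly for $p\in I$ and for $t\in H$ with $\mu+t\in\mathbb{Z}_{\ge0}$, one has the complete asymptotic expansion $$\log\Bigl[\sqrt{2\pi\sigma^{2}}\;P(\mu+t)\Bigr]\sim\sum_{n\ge1}\frac{A_n(t;p)}{r^{n}},$$ where $$A_n(t;p)=\frac{(-1)^{n+1}}{n(n+1)}\Bigl[p^{n}B_{n+1}(t)-\Bigl(\frac pq\Bigr)^{n}B_{n+1}(t+1)-B_{n+1}\Bigr].$$ In particular $$A_1(t;p)=-\frac{p^{2}}{2q}\,B_2(t)-\frac pq\,t-\frac1{12},\qquad A_2(t;p)=-\frac16\Bigl[p^{2}B_3(t)-\frac{p^{2}}{q^{2}}\,B_3(t+1)\Bigr].$$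
   Context: For real $r>0$ and $p\in(0,1)$, put $q=1-p$. The negative binomial law $\mathrm{NB}(r,p)$ (failures parametrisation) has mass function $$P(k)=\frac{\Gamma(k+r)}{\Gamma(r)\,\Gamma(k+1)}\,p^{r}q^{k},\qquad k\in\mathbb{Z}_{\ge0},$$ and $\mu=rq/p$, $\sigma^{2}=rq/p^{2}$ are its mean and variance. $B_n(t)$ denotes the Bernoulli polynomials, $\sum_{n\ge0}B_n(t)z^n/n!=ze^{tz}/(e^z-1)$, and $B_n=B_n(0)$ the Bernoulli numbers (so $B_1=-\tfrac12$). Meaning of the expansion: for every fixed integer $M\ge0$, the difference between the left-hand side and $\sum_{n=1}^{M}A_n(t;p)r^{-n}$ is $O(r^{-M-1})$ as $r\to\infty$, with implied constant and threshold on $r$ depending only on $M$, $I$, $H$. *)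

theory Defs
  imports "HOL-Analysis.Analysis" "HOL-Computational_Algebra.Formal_Power_Series"
begin

text \<open>The generating function \<open>z e^(t z) / (e^z - 1)\<close> as a formal power series in \<open>z\<close>; its
  denominator has subdegree 1, so the quotient is exact (see \<open>bernoulli_gf_times\<close>).\<close>

definition bernoulli_gf :: "real \<Rightarrow> real fps" where
  "bernoulli_gf t = (fps_X * fps_exp t) / (fps_exp 1 - 1)"

definition bernoulli_poly :: "nat \<Rightarrow> real \<Rightarrow> real" where
  "bernoulli_poly n t = fact n * fps_nth (bernoulli_gf t) n"

definition bernoulli_number :: "nat \<Rightarrow> real" where
  "bernoulli_number n = bernoulli_poly n 0"

lemma bernoulli_gf_times: "bernoulli_gf t * (fps_exp 1 - 1) = fps_X * fps_exp t"
proof -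
  have nth1: "fps_nth (fps_exp 1 - 1 :: real fps) 1 = 1" by simp
  hence nz: "(fps_exp 1 - 1 :: real fps) \<noteq> 0" by (metis fps_zero_nth zero_neq_one)
  have "subdegree (fps_exp 1 - 1 :: real fps) \<le> 1"
    by (rule subdegree_leI) (simp add: nth1)
  also have "1 \<le> subdegree (fps_X * fps_exp t :: real fps)"
    by (simp add: subdegree_mult)
  finally have "(fps_exp 1 - 1 :: real fps) dvd fps_X * fps_exp t"
    using nz by (simp add: fps_dvd_iff)
  thus ?thesis by (simp add: bernoulli_gf_def)
qed

definition nb_mass :: "real \<Rightarrow> real \<Rightarrow> nat \<Rightarrow> real" where
  "nb_mass r p k =
     Gamma (real k + r) / (Gamma r * Gamma (real k + 1)) * p powr r * (1 - p) ^ k"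

definition nb_mean :: "real \<Rightarrow> real \<Rightarrow> real" where
  "nb_mean r p = r * (1 - p) / p"

definition nb_variance :: "real \<Rightarrow> real \<Rightarrow> real" where
  "nb_variance r p = r * (1 - p) / p ^ 2"

definition nb_coeff :: "nat \<Rightarrow> real \<Rightarrow> real \<Rightarrow> real" where
  "nb_coeff n t p =
     (- 1) ^ (n + 1) / (real n * real (n + 1)) *
       (p ^ n * bernoulli_poly (n + 1) t
        - (p / (1 - p)) ^ n * bernoulli_poly (n + 1) (t + 1)
        - bernoulli_number (n + 1))"

end

theory Submission
  imports Defs "HOL-Real_Asymp.Real_Asymp"
begin

text \<open>
  Taking logarithms turns the mass function into \<open>ln \<Gamma>(r/p + t) - ln \<Gamma>(\<mu> + t + 1) - ln \<Gamma>(r)\<close>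
  plus elementary terms, because \<open>k + r = r/p + t\<close> and \<open>k + 1 = \<mu> + (t + 1)\<close> when \<open>k = \<mu> + t\<close>. Each of the
  three terms has the form \<open>ln \<Gamma>(z + a)\<close> with \<open>a\<close> bounded and \<open>z\<close> at least a fixed multiple of \<open>r\<close>, so the
  expansion follows from the shifted Stirling series
    \<open>ln \<Gamma>(z + a) \<sim> (z + a - 1/2) ln z - z + 1/2 ln (2\<pi>) + \<Sum>_n (-1)^(n+1) B_(n+1)(a) / (n (n + 1) z^n)\<close>,
  provided that it holds uniformly for bounded \<open>a\<close> (\<open>ln_Gamma_stirling_bound\<close>). The logarithmic terms
  cancel exactly (\<open>ln_nb_mass_decomposition\<close>), and the coefficients of \<open>r^(-n)\<close> combine to \<open>nb_coeff n t p\<close>.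

  The shifted Stirling series is obtained from the functional equation of \<open>\<Gamma>\<close>, without any integral
  representation. Write \<open>S_M(a, z)\<close> for the series truncated after \<open>n = M\<close>, without its constant.
  Passing from \<open>(a, z)\<close> to \<open>(a, z + 1)\<close> is done in two moves. Raising \<open>a\<close> to \<open>a + 1\<close> adds, by
  \<open>B_n(a + 1) - B_n(a) = n a^(n-1)\<close>, exactly \<open>ln z\<close> plus the Taylor polynomial of \<open>ln (1 + a/z)\<close>, hence
  \<open>ln (z + a)\<close> up to \<open>O(z^(-M-1))\<close>. Moving along \<open>h \<mapsto> (a + 1 - h, z + h)\<close>, where \<open>z + a\<close> is constant, changes
  \<open>S_M\<close> by only \<open>O(z^(-M-1))\<close>: since \<open>B_n' = n B_(n-1)\<close>, its derivative telescopes to a single term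
  (\<open>stirling_sum_derivative_antidiagonal\<close>). So the error \<open>ln \<Gamma>(z + a) - S_M(a, z)\<close> changes by
  \<open>O(z^(-M-1))\<close> under \<open>z \<mapsto> z + 1\<close>; summing these changes along \<open>z, z + 1, \<dots>\<close> shows that it is within
  \<open>O(z^(-M))\<close> of its pointwise limit (\<open>M \<ge> 1\<close>). The one power of \<open>z\<close> lost in the summation
  is regained by using \<open>M + 1\<close> in place of \<open>M\<close>. The limit is \<open>\<onehalf> ln (2\<pi>)\<close> by Stirling's formula for
  integers and \<open>\<Gamma>(n + x) \<sim> \<Gamma>(n) n^x\<close>.
\<close>

section \<open>Bernoulli polynomials\<close>

lemma bernoulli_gf_0_times_exp: "bernoulli_gf t = bernoulli_gf 0 * fps_exp t"
proof -
  have "fps_nth (fps_exp 1 - 1 :: real fps) 1 \<noteq> 0" by simp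
  hence nz: "(fps_exp 1 - 1 :: real fps) \<noteq> 0" by (metis fps_zero_nth)
  have "bernoulli_gf t * (fps_exp 1 - 1) = (bernoulli_gf 0 * fps_exp t) * (fps_exp 1 - 1)"
    using bernoulli_gf_times[of t] bernoulli_gf_times[of 0] by (simp add: mult_ac)
  with nz show ?thesis by simp
qed

text \<open>The generating functions at \<open>t + 1\<close> and \<open>t\<close> differ by the factor \<open>e^z\<close>, so their difference picks up
  \<open>e^z - 1\<close>, which cancels the denominator and leaves \<open>z e^(tz)\<close>.\<close>

lemma bernoulli_poly_diff:
  "bernoulli_poly (Suc n) (t + 1) - bernoulli_poly (Suc n) t = real (Suc n) * t ^ n"
proof -
  have "bernoulli_gf (t + 1) - bernoulli_gf t = fps_exp t * (bernoulli_gf 0 * (fps_exp 1 - 1))"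
    by (subst (1 2) bernoulli_gf_0_times_exp) (simp add: fps_exp_add_mult algebra_simps)
  also have "\<dots> = fps_X * fps_exp t"
    by (simp add: bernoulli_gf_times mult_ac)
  finally have "fps_nth (bernoulli_gf (t + 1) - bernoulli_gf t) (Suc n) = t ^ n / fact n"
    by simp
  hence "fps_nth (bernoulli_gf (t + 1)) (Suc n) = fps_nth (bernoulli_gf t) (Suc n) + t ^ n / fact n"
    by simp
  thus ?thesis
    by (simp add: bernoulli_poly_def distrib_left)
qed

text \<open>Formally, \<open>\<partial>/\<partial>t\<close> multiplies the generating function by \<open>z\<close>, which shifts its coefficients. The proof
  expands the product with \<open>e^(tz)\<close>, so that every coefficient is an explicit polynomial in \<open>t\<close>.\<close>

lemma has_field_derivative_bernoulli_poly:
  "((\<lambda>t. bernoulli_poly (Suc n) t) has_field_derivative real (Suc n) * bernoulli_poly n t) (at t)"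
proof -
  define b where "b = fps_nth (bernoulli_gf 0)"
  have expand: "fps_nth (bernoulli_gf x) m = (\<Sum>i=0..m. b i * (x ^ (m - i) / fact (m - i)))" for x m
    by (subst bernoulli_gf_0_times_exp) (simp add: fps_mult_nth b_def)
  have "((\<lambda>x. b i * (x ^ (Suc n - i) / fact (Suc n - i))) has_field_derivative
      b i * (t ^ (n - i) / fact (n - i))) (at t)" if "i \<le> n" for i
  proof -
    from le_Suc_ex[OF that] obtain d where n: "n = i + d" ..
    have "((\<lambda>x. b i / fact (Suc d) * x ^ Suc d) has_field_derivative
        b i / fact (Suc d) * (real (Suc d) * t ^ d)) (at t)"
      using DERIV_cmult[OF DERIV_pow[of "Suc d" t UNIV], of "b i / fact (Suc d)"]
      by (simp del: fact_Suc of_nat_Suc power_Suc)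
    also have "b i / fact (Suc d) * (real (Suc d) * t ^ d) = b i * (t ^ (n - i) / fact (n - i))"
      by (simp add: n del: of_nat_Suc)
    finally show ?thesis by (simp add: n del: fact_Suc)
  qed
  hence "((\<lambda>x. (\<Sum>i=0..n. b i * (x ^ (Suc n - i) / fact (Suc n - i))) + b (Suc n))
      has_field_derivative (\<Sum>i=0..n. b i * (t ^ (n - i) / fact (n - i))) + 0) (at t)"
    by (intro DERIV_add DERIV_sum DERIV_const) auto
  hence "((\<lambda>x. fps_nth (bernoulli_gf x) (Suc n)) has_field_derivative
      fps_nth (bernoulli_gf t) n) (at t)"
    by (simp add: expand)
  from DERIV_cmult[OF this, of "fact (Suc n)"] show ?thesis
    by (simp add: bernoulli_poly_def mult_ac)
qed

lemma bernoulli_poly_0 [simp]: "bernoulli_poly 0 t = 1"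
proof -
  have "bernoulli_poly 0 t = bernoulli_poly 1 (t + 1) - bernoulli_poly 1 t"
    using arg_cong[OF bernoulli_gf_times[of t], of "\<lambda>f. fps_nth f 1"]
      bernoulli_poly_diff[of 0 t]
    by (simp add: fps_mult_nth bernoulli_poly_def)
  thus ?thesis using bernoulli_poly_diff[of 0 t] by simp
qed

lemma bernoulli_poly_1: "bernoulli_poly 1 t = t - 1 / 2"
  using arg_cong[OF bernoulli_gf_times[of t], of "\<lambda>f. fps_nth f 2"] bernoulli_poly_0[of t]
  by (simp add: fps_mult_nth bernoulli_poly_def eval_nat_numeral)

lemma bernoulli_number_2: "bernoulli_number 2 = 1 / 6"
  using arg_cong[OF bernoulli_gf_times[of 0], of "\<lambda>f. fps_nth f 3"]
    bernoulli_poly_0[of 0] bernoulli_poly_1[of 0]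
  by (simp add: fps_mult_nth bernoulli_poly_def bernoulli_number_def eval_nat_numeral)

lemma bernoulli_number_3: "bernoulli_number 3 = 0"
  using arg_cong[OF bernoulli_gf_times[of 0], of "\<lambda>f. fps_nth f 4"]
    bernoulli_poly_0[of 0] bernoulli_poly_1[of 0] bernoulli_number_2
  by (simp add: fps_mult_nth bernoulli_poly_def bernoulli_number_def eval_nat_numeral)

lemma bernoulli_poly_bounded:
  obtains C where "C \<ge> 0" "\<And>t. \<bar>t\<bar> \<le> A \<Longrightarrow> \<bar>bernoulli_poly n t\<bar> \<le> C"
proof -
  have "continuous_on {-A..A} (bernoulli_poly n)"
  proof (cases n)
    case (Suc m)
    show ?thesis unfolding Suc
      by (rule DERIV_continuous_on, rule DERIV_subset[OF has_field_derivative_bernoulli_poly]) auto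
  qed (simp add: bernoulli_poly_0[abs_def])
  hence "bounded (bernoulli_poly n ` {-A..A})"
    by (intro compact_imp_bounded compact_continuous_image) auto
  then obtain C where C: "\<forall>x\<in>bernoulli_poly n ` {-A..A}. norm x \<le> C"
    by (auto simp: bounded_iff)
  show thesis
  proof (rule that[of "max 0 C"])
    fix t assume "\<bar>t\<bar> \<le> A"
    hence "t \<in> {-A..A}" by auto
    with C have "\<bar>bernoulli_poly n t\<bar> \<le> C" by simp
    thus "\<bar>bernoulli_poly n t\<bar> \<le> max 0 C" by simp
  qed simp
qed

section \<open>Truncated Stirling series with a shift\<close>

text \<open>
  The derivative of the remainder is, by the geometric sum, the single term \<open>(-y)^M / (1 + y)\<close>, and
  \<open>1 + y \<ge> 1/2\<close> on the interval considered; this treats both signs of \<open>x\<close> at once.\<close>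

lemma ln_one_plus_taylor_bound:
  fixes x :: real
  assumes "\<bar>x\<bar> \<le> 1 / 2"
  shows "\<bar>ln (1 + x) - (\<Sum>n=1..M. (-1) ^ (n + 1) * x ^ n / real n)\<bar> \<le> 2 * \<bar>x\<bar> ^ (M + 1)"
proof -
  define D where "D = (\<lambda>x::real. ln (1 + x) - (\<Sum>n=1..M. (-1) ^ (n + 1) * x ^ n / real n))"
  have "norm (D x - D 0) \<le> 2 * \<bar>x\<bar> ^ M * norm (x - 0)"
  proof (rule field_differentiable_bound)
    show "convex (cball (0::real) \<bar>x\<bar>)" by simp
    fix y :: real assume "y \<in> cball 0 \<bar>x\<bar>"
    hence y: "\<bar>y\<bar> \<le> \<bar>x\<bar>" by simp
    have geo: "(\<Sum>n=1..m. (-1) ^ (n + 1) * y ^ (n - 1)) = (1 - (-y) ^ m) / (1 + y)" for m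
      using y assms by (induction m) (auto simp: field_simps power_minus')
    have "(D has_field_derivative 1 / (1 + y) - (\<Sum>n=1..M. (-1) ^ (n + 1) * y ^ (n - 1))) (at y)"
      unfolding D_def using y assms
      by (auto intro!: derivative_eq_intros sum.cong simp: divide_simps)
    also have "1 / (1 + y) - (\<Sum>n=1..M. (-1) ^ (n + 1) * y ^ (n - 1)) = (-y) ^ M / (1 + y)"
      unfolding geo by (simp add: diff_divide_distrib)
    finally show "(D has_field_derivative (-y) ^ M / (1 + y)) (at y within cball 0 \<bar>x\<bar>)"
      by (rule DERIV_subset) simp
    have "\<bar>y\<bar> ^ M / \<bar>1 + y\<bar> \<le> \<bar>x\<bar> ^ M / (1 / 2)"
      using y assms by (intro frac_le power_mono) auto
    thus "norm ((-y) ^ M / (1 + y)) \<le> 2 * \<bar>x\<bar> ^ M"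
      by (simp add: power_abs)
  qed auto
  moreover have "D 0 = 0" by (simp add: D_def power_0_left)
  ultimately show ?thesis by (simp add: D_def mult_ac)
qed

text \<open>The expansion of \<open>ln \<Gamma>(z + a)\<close> through order \<open>z^(-M)\<close>. The constant \<open>\<onehalf> ln (2\<pi>)\<close> is left out because
  it is invisible to the difference equation in \<open>z\<close> and is determined separately.\<close>

definition stirling_sum :: "nat \<Rightarrow> real \<Rightarrow> real \<Rightarrow> real" where
  "stirling_sum M a z = (z + a - 1 / 2) * ln z - z +
     (\<Sum>n=1..M. (-1) ^ (n + 1) * bernoulli_poly (n + 1) a / (real n * real (n + 1)) / z ^ n)"

lemma stirling_sum_Suc:
  "stirling_sum (Suc M) a z = stirling_sum M a z +
     (-1) ^ M * bernoulli_poly (M + 2) a / (real (M + 1) * real (M + 2)) / z ^ (M + 1)"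
  by (simp add: stirling_sum_def)

lemma stirling_sum_diff_argument:
  assumes "z > 0"
  shows "stirling_sum M (a + 1) z - stirling_sum M a z =
    ln z + (\<Sum>n=1..M. (-1) ^ (n + 1) * (a / z) ^ n / real n)"
proof -
  have "(-1) ^ (n + 1) * bernoulli_poly (n + 1) (a + 1) / (real n * real (n + 1)) / z ^ n -
      (-1) ^ (n + 1) * bernoulli_poly (n + 1) a / (real n * real (n + 1)) / z ^ n =
      (-1) ^ (n + 1) * (a / z) ^ n / real n" if "n \<in> {1..M}" for n
  proof -
    have "(-1) ^ (n + 1) * bernoulli_poly (n + 1) (a + 1) / (real n * real (n + 1)) / z ^ n -
      (-1) ^ (n + 1) * bernoulli_poly (n + 1) a / (real n * real (n + 1)) / z ^ n =
      (-1) ^ (n + 1) * (bernoulli_poly (Suc n) (a + 1) - bernoulli_poly (Suc n) a)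
         / (real n * real (n + 1)) / z ^ n"
      by (simp add: diff_divide_distrib right_diff_distrib)
    also have "\<dots> = (-1) ^ (n + 1) * (a / z) ^ n / real n"
      unfolding bernoulli_poly_diff using that assms
      by (simp add: power_divide del: of_nat_Suc)
    finally show ?thesis .
  qed
  hence "(\<Sum>n=1..M. (-1) ^ (n + 1) * bernoulli_poly (n + 1) (a + 1) / (real n * real (n + 1)) / z ^ n) -
      (\<Sum>n=1..M. (-1) ^ (n + 1) * bernoulli_poly (n + 1) a / (real n * real (n + 1)) / z ^ n) =
      (\<Sum>n=1..M. (-1) ^ (n + 1) * (a / z) ^ n / real n)"
    unfolding sum_subtractf[symmetric] by (rule sum.cong[OF refl])
  thus ?thesis by (simp add: stirling_sum_def algebra_simps)
qed

text \<open>\<open>\<partial>S_M/\<partial>z\<close> and \<open>\<partial>S_M/\<partial>a\<close> are both truncations of the series \<open>ln z + \<Sum>_m (-1)^(m+1) B_m(a) / (m z^m)\<close>, the former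
  after \<open>m = M + 1\<close> and the latter after \<open>m = M\<close>. Hence their difference is the last term alone,
  small as it should be, since \<open>ln \<Gamma>(z + a)\<close> itself is constant along this direction.\<close>

lemma stirling_sum_derivative_antidiagonal:
  assumes "z + h > 0"
  shows "((\<lambda>h. stirling_sum M (a - h) (z + h)) has_field_derivative
    (-1) ^ M * bernoulli_poly (M + 1) (a - h) / (real (M + 1) * (z + h) ^ (M + 1))) (at h)"
proof (induction M)
  case 0
  have "(z + a - 1 / 2) / (z + h) - 1 = ((z + a - 1 / 2) - (z + h)) / (z + h)"
    using assms by (subst diff_divide_distrib) simp
  also have "(z + a - 1 / 2) - (z + h) = a - h - 1 / 2"
    by simp
  finally have "((\<lambda>h. (z + a - 1 / 2) * ln (z + h) - (z + h)) has_field_derivative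
      (a - h - 1 / 2) / (z + h)) (at h)"
    using assms by (auto intro!: derivative_eq_intros)
  thus ?case
    by (simp add: stirling_sum_def bernoulli_poly_1[unfolded One_nat_def])
next
  case (Suc M)
  have "((\<lambda>h. bernoulli_poly (Suc (Suc M)) (a - h)) has_field_derivative
      (real (Suc (Suc M)) * bernoulli_poly (Suc M) (a - h)) * (-1)) (at h)"
    by (rule DERIV_chain2[OF has_field_derivative_bernoulli_poly])
       (auto intro!: derivative_eq_intros)
  moreover have "((\<lambda>h. z + h) has_field_derivative 1) (at h)"
    by (auto intro!: derivative_eq_intros)
  from DERIV_power[OF this, of "Suc M"]
  have "((\<lambda>h. (z + h) ^ (M + 1)) has_field_derivative real (M + 1) * (z + h) ^ M) (at h)"
    by (simp del: power_Suc)
  ultimately have "((\<lambda>h. bernoulli_poly (Suc (Suc M)) (a - h) / (z + h) ^ (M + 1)) has_field_derivative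
     (real (Suc (Suc M)) * bernoulli_poly (Suc M) (a - h) * (-1) * (z + h) ^ (M + 1)
       - bernoulli_poly (Suc (Suc M)) (a - h) * (real (M + 1) * (z + h) ^ M))
      / ((z + h) ^ (M + 1) * (z + h) ^ (M + 1))) (at h)"
    using assms by (intro DERIV_divide) auto
  also have "(real (Suc (Suc M)) * bernoulli_poly (Suc M) (a - h) * (-1) * (z + h) ^ (M + 1)
       - bernoulli_poly (Suc (Suc M)) (a - h) * (real (M + 1) * (z + h) ^ M))
      / ((z + h) ^ (M + 1) * (z + h) ^ (M + 1)) =
      - (real (M + 2) * bernoulli_poly (M + 1) (a - h) / (z + h) ^ (M + 1))
      - bernoulli_poly (M + 2) (a - h) * real (M + 1) / (z + h) ^ (M + 2)"
    using assms by (simp add: diff_divide_distrib)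
  finally have "((\<lambda>h. stirling_sum M (a - h) (z + h) + (-1) ^ M / (real (M + 1) * real (M + 2)) *
        (bernoulli_poly (Suc (Suc M)) (a - h) / (z + h) ^ (M + 1))) has_field_derivative
      (-1) ^ M * bernoulli_poly (M + 1) (a - h) / (real (M + 1) * (z + h) ^ (M + 1)) +
      (-1) ^ M / (real (M + 1) * real (M + 2)) *
        (- (real (M + 2) * bernoulli_poly (M + 1) (a - h) / (z + h) ^ (M + 1))
         - bernoulli_poly (M + 2) (a - h) * real (M + 1) / (z + h) ^ (M + 2))) (at h)"
    by (intro DERIV_add Suc DERIV_cmult)
  (* The a-derivative of the new term cancels the remainder of order M; its z-derivative is the
     remainder of order M + 1. *)
  also have "(-1) ^ M * bernoulli_poly (M + 1) (a - h) / (real (M + 1) * (z + h) ^ (M + 1)) +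
      (-1) ^ M / (real (M + 1) * real (M + 2)) *
        (- (real (M + 2) * bernoulli_poly (M + 1) (a - h) / (z + h) ^ (M + 1))
         - bernoulli_poly (M + 2) (a - h) * real (M + 1) / (z + h) ^ (M + 2)) =
      (-1) ^ Suc M * bernoulli_poly (Suc M + 1) (a - h) / (real (Suc M + 1) * (z + h) ^ (Suc M + 1))"
  proof -
    have cancel: "s * x / (m * u) + s / (m * n) * (- (n * x / u) - y * m / v) = - s * y / (n * v)"
      if "m > 0" "n > 0" "u > 0" "v > 0" for s x m n u v y :: real
      using that by (simp add: field_simps)
    show ?thesis
      by (subst cancel) (use assms in auto)
  qed
  finally show ?case
    by (simp add: stirling_sum_Suc)
qed

text \<open>\<open>S_M\<close> satisfies the functional equation of \<open>ln \<Gamma>(z + a)\<close> up to \<open>O(z^(-M-1))\<close>: the step from \<open>(a, z)\<close> to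
  \<open>(a, z + 1)\<close> passes through \<open>(a + 1, z)\<close>, with a mean value estimate on the second leg. The bound
  \<open>z \<ge> 2A + 1\<close> guarantees \<open>\<bar>a / z\<bar> \<le> 1/2\<close> and \<open>z \<ge> 1\<close>.\<close>

lemma stirling_sum_shift_bound:
  assumes "A \<ge> 0"
  obtains C where "\<And>a z. \<bar>a\<bar> \<le> A \<Longrightarrow> z \<ge> 2 * A + 1 \<Longrightarrow>
    \<bar>stirling_sum M a (z + 1) - stirling_sum M a z - ln (z + a)\<bar> \<le> C / z ^ (M + 1)"
proof -
  obtain B where B: "B \<ge> 0" "\<And>t. \<bar>t\<bar> \<le> A + 1 \<Longrightarrow> \<bar>bernoulli_poly (M + 1) t\<bar> \<le> B"
    using bernoulli_poly_bounded[of "A + 1" "M + 1"] by blast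
  show thesis
  proof (rule that[of "B + 2 * A ^ (M + 1)"])
    fix a z :: real assume a: "\<bar>a\<bar> \<le> A" and z: "z \<ge> 2 * A + 1"
    from z assms have z0: "z > 0" by simp
    have "norm (stirling_sum M (a + 1 - 1) (z + 1) - stirling_sum M (a + 1 - 0) (z + 0)) \<le>
        B / z ^ (M + 1) * norm (1 - 0 :: real)"
    proof (rule field_differentiable_bound[where S = "{0..1}"])
      fix h :: real assume h: "h \<in> {0..1}"
      show "((\<lambda>h. stirling_sum M (a + 1 - h) (z + h)) has_field_derivative
          (-1) ^ M * bernoulli_poly (M + 1) (a + 1 - h) / (real (M + 1) * (z + h) ^ (M + 1)))
          (at h within {0..1})"
        by (rule DERIV_subset[OF stirling_sum_derivative_antidiagonal]) (use z0 h in auto)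
      have "\<bar>bernoulli_poly (M + 1) (a + 1 - h)\<bar> / (real (M + 1) * (z + h) ^ (M + 1)) \<le>
          B / (1 * z ^ (M + 1))"
        using a h z0 B by (intro frac_le mult_mono power_mono B) auto
      thus "norm ((-1) ^ M * bernoulli_poly (M + 1) (a + 1 - h) / (real (M + 1) * (z + h) ^ (M + 1)))
          \<le> B / z ^ (M + 1)"
        using z0 h by (simp add: abs_mult power_abs)
    qed auto
    hence 1: "\<bar>stirling_sum M a (z + 1) - stirling_sum M (a + 1) z\<bar> \<le> B / z ^ (M + 1)"
      by simp
    have az: "\<bar>a / z\<bar> \<le> 1 / 2" using a z z0 by (simp add: field_simps)
    have "z + a = z * (1 + a / z)" using z0 by (simp add: distrib_left)
    hence "ln (z + a) = ln (z * (1 + a / z))" by simp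
    also have "\<dots> = ln z + ln (1 + a / z)"
    proof (rule ln_mult_pos)
      show "1 + a / z > 0" using az by linarith
    qed (use z0 in auto)
    finally have "\<bar>stirling_sum M (a + 1) z - stirling_sum M a z - ln (z + a)\<bar> \<le>
        2 * \<bar>a / z\<bar> ^ (M + 1)"
      using ln_one_plus_taylor_bound[OF az, of M] stirling_sum_diff_argument[OF z0, of M a]
      by linarith
    also have "\<bar>a / z\<bar> ^ (M + 1) \<le> (A / z) ^ (M + 1)"
      using a z0 by (intro power_mono) (auto simp: divide_right_mono)
    finally have "\<bar>stirling_sum M (a + 1) z - stirling_sum M a z - ln (z + a)\<bar> \<le>
        2 * A ^ (M + 1) / z ^ (M + 1)"
      by (simp add: power_divide)
    with 1 show "\<bar>stirling_sum M a (z + 1) - stirling_sum M a z - ln (z + a)\<bar> \<le>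
        (B + 2 * A ^ (M + 1)) / z ^ (M + 1)"
      unfolding add_divide_distrib by linarith
  qed
qed

section \<open>From the difference equation to the Stirling series\<close>

text \<open>
  Summing the steps costs one power of \<open>z\<close>. The sum of \<open>x^(-M-1)\<close> over \<open>x = z, z + 1, \<dots>\<close> is dominated by a
  telescoping one with total \<open>2 z^(-M)\<close>.\<close>

lemma telescoping_power_bound:
  fixes f :: "real \<Rightarrow> real"
  assumes M: "M \<ge> 1" and Z: "Z \<ge> 1"
    and step: "\<And>x. x \<ge> Z \<Longrightarrow> \<bar>f (x + 1) - f x\<bar> \<le> C / x ^ (M + 1)"
    and z: "z \<ge> Z"
  shows "\<bar>f (z + real n) - f z\<bar> \<le> 2 * C / z ^ M"
proof -
  have "0 \<le> C / Z ^ (M + 1)" using step[of Z] by linarith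
  moreover have "Z ^ (M + 1) > 0" using Z by simp
  ultimately have C: "C \<ge> 0" by (simp only: zero_le_divide_iff) linarith
  have majorant: "1 / x ^ (M + 1) \<le> 2 * (1 / x ^ M - 1 / (x + 1) ^ M)" if x: "x \<ge> 1" for x :: real
  proof -
    have "(x / (x + 1)) ^ M \<le> (x / (x + 1)) ^ 1"
      using M x by (intro power_decreasing) auto
    hence "1 / x ^ M * (1 - x / (x + 1)) \<le> 1 / x ^ M * (1 - (x / (x + 1)) ^ M)"
      using x by (intro mult_left_mono) auto
    also have "\<dots> = 1 / x ^ M - 1 / (x + 1) ^ M"
      using x by (simp add: power_divide field_simps)
    finally have diff: "1 / x ^ M * (1 - x / (x + 1)) \<le> 1 / x ^ M - 1 / (x + 1) ^ M" .
    have "1 / x * (1 / 2) \<le> 1 - x / (x + 1)"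
      using x by (simp add: field_simps)
    hence half: "1 / x ^ M * (1 / x * (1 / 2)) \<le> 1 / x ^ M * (1 - x / (x + 1))"
      using x by (intro mult_left_mono) auto
    have "1 / x ^ (M + 1) = 2 * (1 / x ^ M * (1 / x * (1 / 2)))"
      by simp
    also have "\<dots> \<le> 2 * (1 / x ^ M - 1 / (x + 1) ^ M)"
      by (intro mult_left_mono order.trans[OF half diff]) simp
    finally show ?thesis .
  qed
  have "\<bar>f (z + real n) - f z\<bar> \<le> 2 * C * (1 / z ^ M - 1 / (z + real n) ^ M)"
  proof (induction n)
    case (Suc n)
    have "\<bar>f (z + real n + 1) - f (z + real n)\<bar> \<le> C * (1 / (z + real n) ^ (M + 1))"
      using step[of "z + real n"] z by simp
    also have "\<dots> \<le> C * (2 * (1 / (z + real n) ^ M - 1 / (z + real n + 1) ^ M))"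
      using z Z C by (intro mult_left_mono majorant) auto
    finally show ?case using Suc by (simp add: algebra_simps)
  qed simp
  also have "\<dots> \<le> 2 * C * (1 / z ^ M)"
    using C z Z by (intro mult_left_mono) auto
  finally show ?thesis by simp
qed

lemma ln_Gamma_real_plus1:
  assumes "x > (0::real)"
  shows "ln_Gamma (x + 1) = ln x + ln_Gamma x"
proof -
  have "x \<notin> \<int>\<^sub>\<le>\<^sub>0" using assms by (auto elim!: nonpos_Ints_cases)
  thus ?thesis using assms by (simp add: ln_Gamma_real_pos Gamma_plus1 ln_mult_pos)
qed

text \<open>This is the logarithm of the limit \<open>(n - 1)! n^x / (x (x + 1) \<cdots> (x + n - 1)) \<longlonglongrightarrow> \<Gamma>(x)\<close>. It reduces the
  pointwise limit for a real shift to the one along the integers.\<close>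

lemma ln_Gamma_add_nat_asymp:
  assumes "x > (0::real)"
  shows "(\<lambda>n. ln_Gamma (x + real n) - ln_Gamma (real n) - x * ln (real n)) \<longlonglongrightarrow> 0"
proof -
  have x: "x \<notin> \<int>\<^sub>\<le>\<^sub>0" using assms by (auto elim!: nonpos_Ints_cases)
  have "(\<lambda>n. ln_Gamma x - ln (Gamma_series' x n)) \<longlonglongrightarrow> ln_Gamma x - ln (Gamma x)"
    using assms by (intro tendsto_intros Gamma_series'_LIMSEQ) (simp add: Gamma_real_pos less_imp_neq[symmetric])
  also have "ln_Gamma x - ln (Gamma x) = 0" using assms by (simp add: ln_Gamma_real_pos)
  finally show ?thesis
  proof (rule Lim_transform_eventually)
    show "\<forall>\<^sub>F n in sequentially. ln_Gamma x - ln (Gamma_series' x n) =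
        ln_Gamma (x + real n) - ln_Gamma (real n) - x * ln (real n)"
      using eventually_gt_at_top[of 0]
    proof eventually_elim
      case (elim n)
      have "Gamma_series' x n = Gamma (real n) * exp (x * ln (real n)) / (Gamma (x + real n) / Gamma x)"
        using elim x Gamma_fact[of "n - 1", where ?'a = real]
        by (simp add: Gamma_series'_def pochhammer_Gamma of_nat_diff)
      moreover have "Gamma x \<noteq> 0" "Gamma (real n) \<noteq> 0" "Gamma (x + real n) \<noteq> 0"
        using assms elim by (auto intro!: Gamma_real_pos less_imp_neq[symmetric])
      ultimately show ?case using assms elim
        by (simp add: ln_div ln_mult_pos ln_Gamma_real_pos)
    qed
  qed
qed

text \<open>The telescoping bound makes the sequence Cauchy, so only the value \<open>c\<close> of its limit is at stake. It is
  found by comparing the terms at \<open>n\<close> and \<open>2n\<close>: the product limit of \<open>\<Gamma>(1/2) = \<surd>\<pi>\<close> involves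
  \<open>(1/2)(3/2) \<cdots> (n - 1/2) = (2n)! / (4^n n!)\<close>, and this gives \<open>2c - c - \<onehalf> ln 2 = \<onehalf> ln \<pi>\<close>.\<close>

lemma stirling_ln_Gamma_nat:
  "(\<lambda>n. ln_Gamma (real n) - stirling_sum 0 0 (real n)) \<longlonglongrightarrow> ln (2 * pi) / 2"
proof -
  (* The order 1 truncation is used for convergence because its differences O(1/x^2) are summable;
     the orders 0 and 1 differ by O(1/n) and have the same limit. *)
  define f :: "real \<Rightarrow> real" where "f = (\<lambda>x. ln_Gamma x - stirling_sum 1 0 x)"
  define y where "y = (\<lambda>n. ln_Gamma (real n) - stirling_sum 0 0 (real n))"
  obtain C where C: "\<And>a z. \<bar>a\<bar> \<le> 0 \<Longrightarrow> z \<ge> 2 * 0 + 1 \<Longrightarrow>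
    \<bar>stirling_sum 1 a (z + 1) - stirling_sum 1 a z - ln (z + a)\<bar> \<le> C / z ^ (1 + 1)"
    using stirling_sum_shift_bound[of 0 1] by auto
  have step: "\<bar>f (x + 1) - f x\<bar> \<le> C / x ^ (1 + 1)" if "x \<ge> 1" for x
    using C[of 0 x] that ln_Gamma_real_plus1[of x] by (simp add: f_def)
  have tel: "\<bar>f (z + real n) - f z\<bar> \<le> 2 * C / z ^ 1" if "z \<ge> 1" for z n
    by (rule telescoping_power_bound[of 1 1]) (use step that in auto)
  have "Cauchy (\<lambda>n. f (real n))"
  proof (rule CauchyI')
    fix e :: real assume e: "e > 0"
    obtain N :: nat where N: "real N > max 1 (2 * C / e)" using reals_Archimedean2 by blast
    have "dist (f (real m)) (f (real n)) < e" if mn: "m \<ge> N" "n > m" for m n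
    proof -
      have m: "real m > 1" "real m > 2 * C / e" using N mn by auto
      have "dist (f (real m)) (f (real n)) \<le> 2 * C / real m"
        using tel[of "real m" "n - m"] m mn by (simp add: of_nat_diff abs_minus_commute dist_real_def)
      also have "\<dots> < e" using m e by (simp add: field_simps)
      finally show ?thesis .
    qed
    thus "\<exists>M. \<forall>m\<ge>M. \<forall>n>m. dist (f (real m)) (f (real n)) < e" by blast
  qed
  then obtain c where "(\<lambda>n. f (real n)) \<longlonglongrightarrow> c" by (auto simp: Cauchy_convergent_iff convergent_def)
  hence "(\<lambda>n. f (real n) + bernoulli_poly 2 0 / 2 * (1 / real n)) \<longlonglongrightarrow> c + bernoulli_poly 2 0 / 2 * 0"
    by (intro tendsto_intros lim_1_over_n)
  hence y: "y \<longlonglongrightarrow> c"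
    using stirling_sum_Suc[of 0 0] by (simp add: y_def f_def numeral_2_eq_2)
  hence y2: "(\<lambda>n. y (2 * n)) \<longlonglongrightarrow> c"
    using LIMSEQ_subseq_LIMSEQ[of y c "\<lambda>n. 2 * n"] by (simp add: strict_mono_def o_def)
  have "(\<lambda>n. 2 * y n - y (2 * n) - ln 2 / 2) \<longlonglongrightarrow> 2 * c - c - ln 2 / 2"
    by (intro tendsto_intros y y2)
  moreover have "(\<lambda>n. ln (Gamma_series' (1/2) n)) \<longlonglongrightarrow> ln (Gamma (1/2 :: real))"
    by (intro tendsto_intros Gamma_series'_LIMSEQ) (simp add: Gamma_one_half_real)
  hence "(\<lambda>n. 2 * y n - y (2 * n) - ln 2 / 2) \<longlonglongrightarrow> ln (Gamma (1/2 :: real))"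
  proof (rule Lim_transform_eventually)
    show "\<forall>\<^sub>F n in sequentially. ln (Gamma_series' (1/2) n) = 2 * y n - y (2 * n) - ln 2 / 2"
      using eventually_gt_at_top[of 0]
    proof eventually_elim
      case (elim n)
      have fact_pos_eq: "fact m = real m * fact (m - 1)" if "m > 0" for m
        using that by (cases m) auto
      have "pochhammer (1/2 :: real) n = fact (2 * n) / (2 ^ (2 * n) * fact n)"
        by (simp add: fact_double)
      also have "\<dots> = real (2 * n) * fact (2 * n - 1) / (2 ^ (2 * n) * (real n * fact (n - 1)))"
        using elim by (simp only: fact_pos_eq[of n] fact_pos_eq[of "2 * n"])
      also have "\<dots> = 2 * fact (2 * n - 1) / (2 ^ (2 * n) * fact (n - 1))"
        using elim by simp
      finally have "Gamma_series' (1/2 :: real) n =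
          fact (n - 1) * exp (1 / 2 * ln (real n)) / (2 * fact (2 * n - 1) / (2 ^ (2 * n) * fact (n - 1)))"
        by (simp add: Gamma_series'_def)
      hence "ln (Gamma_series' (1/2 :: real) n) = ln (fact (n - 1)) + 1 / 2 * ln (real n) -
          (ln 2 + ln (fact (2 * n - 1)) - (real (2 * n) * ln 2 + ln (fact (n - 1))))"
        by (simp add: ln_div ln_mult_pos ln_realpow del: power_mult)
      moreover have "ln (fact (n - 1)) = y n + (real n - 1 / 2) * ln (real n) - real n"
        using elim by (simp add: y_def stirling_sum_def ln_Gamma_real_conv_fact)
      moreover have "ln (fact (2 * n - 1)) = y (2 * n) + (2 * real n - 1 / 2) * (ln 2 + ln (real n)) - 2 * real n"
        using elim ln_Gamma_real_conv_fact[of "2 * n"]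
        by (simp add: y_def stirling_sum_def ln_mult_pos)
      ultimately show ?case by (simp add: algebra_simps)
    qed
  qed
  ultimately have "2 * c - c - ln 2 / 2 = ln (Gamma (1/2 :: real))"
    by (rule LIMSEQ_unique)
  hence "c = ln (2 * pi) / 2"
    by (simp add: Gamma_one_half_real ln_sqrt ln_mult_pos)
  with y show ?thesis by (simp add: y_def)
qed

text \<open>The limit is only claimed for fixed \<open>z\<close> and \<open>a\<close>; uniformity comes from the telescoping bound.\<close>

lemma ln_Gamma_minus_stirling_sum_tendsto:
  assumes "z > 0" "z + a > 0"
  shows "(\<lambda>n. ln_Gamma (z + real n + a) - stirling_sum M a (z + real n)) \<longlonglongrightarrow> ln (2 * pi) / 2"
proof (induction M)
  case 0
  have "(\<lambda>n. z - (z + a + real n - 1 / 2) * (ln (z + real n) - ln (real n))) \<longlonglongrightarrow> 0"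
    using assms by real_asymp
  from tendsto_add[OF tendsto_add[OF this stirling_ln_Gamma_nat] ln_Gamma_add_nat_asymp[OF assms(2)]]
  show ?case by (simp add: stirling_sum_def algebra_simps)
next
  case (Suc M)
  have "(\<lambda>n. 1 / (z + real n)) \<longlonglongrightarrow> 0" by real_asymp
  hence "(\<lambda>n. (-1) ^ M * bernoulli_poly (M + 2) a / (real (M + 1) * real (M + 2)) *
      (1 / (z + real n)) ^ (M + 1)) \<longlonglongrightarrow>
      (-1) ^ M * bernoulli_poly (M + 2) a / (real (M + 1) * real (M + 2)) * 0 ^ (M + 1)"
    by (intro tendsto_intros)
  from tendsto_diff[OF Suc this] show ?case
    by (simp add: stirling_sum_Suc power_one_over algebra_simps)
qed

text \<open>The truncation of order \<open>M + 1\<close> satisfies the functional equation up to \<open>O(z^(-M-2))\<close>, so its error is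
  \<open>O(z^(-M-1))\<close> after summation; dropping its last term costs no more than that.\<close>

theorem ln_Gamma_stirling_bound:
  assumes "A \<ge> 0"
  obtains C where "\<And>a z. \<bar>a\<bar> \<le> A \<Longrightarrow> z \<ge> 2 * A + 1 \<Longrightarrow>
    \<bar>ln_Gamma (z + a) - stirling_sum M a z - ln (2 * pi) / 2\<bar> \<le> C / z ^ (M + 1)"
proof -
  obtain C where C: "\<And>a z. \<bar>a\<bar> \<le> A \<Longrightarrow> z \<ge> 2 * A + 1 \<Longrightarrow>
    \<bar>stirling_sum (Suc M) a (z + 1) - stirling_sum (Suc M) a z - ln (z + a)\<bar> \<le> C / z ^ (Suc M + 1)"
    using stirling_sum_shift_bound[OF assms, of "Suc M"] by blast
  obtain B where B: "B \<ge> 0" "\<And>t. \<bar>t\<bar> \<le> A \<Longrightarrow> \<bar>bernoulli_poly (M + 2) t\<bar> \<le> B"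
    using bernoulli_poly_bounded[of A "M + 2"] by blast
  show thesis
  proof (rule that[of "2 * C + B"])
    fix a z :: real assume a: "\<bar>a\<bar> \<le> A" and z: "z \<ge> 2 * A + 1"
    define f where "f = (\<lambda>x. ln_Gamma (x + a) - stirling_sum (Suc M) a x)"
    have step: "\<bar>f (x + 1) - f x\<bar> \<le> C / x ^ (Suc M + 1)" if x: "x \<ge> 2 * A + 1" for x
    proof -
      have "ln_Gamma (x + a + 1) = ln (x + a) + ln_Gamma (x + a)"
        using x a assms by (intro ln_Gamma_real_plus1) linarith
      with C[OF a x] show ?thesis by (simp add: f_def add_ac)
    qed
    have "\<bar>f (z + real n) - f z\<bar> \<le> 2 * C / z ^ Suc M" for n
      by (rule telescoping_power_bound[where Z = "2 * A + 1"]) (use step z assms in auto)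
    moreover have "(\<lambda>n. \<bar>f (z + real n) - f z\<bar>) \<longlonglongrightarrow> \<bar>ln (2 * pi) / 2 - f z\<bar>"
      unfolding f_def
      by (intro tendsto_intros ln_Gamma_minus_stirling_sum_tendsto) (use a z assms in linarith)+
    ultimately have "\<bar>ln (2 * pi) / 2 - f z\<bar> \<le> 2 * C / z ^ Suc M"
      by (intro LIMSEQ_le_const2) auto
    hence 1: "\<bar>ln_Gamma (z + a) - stirling_sum (Suc M) a z - ln (2 * pi) / 2\<bar> \<le> 2 * C / z ^ (M + 1)"
      by (simp add: f_def abs_minus_commute)
    have "\<bar>bernoulli_poly (M + 2) a\<bar> / (real (M + 1) * real (M + 2)) \<le> B / 1"
    proof (rule frac_le)
      have "1 * 1 \<le> real (M + 1) * real (M + 2)" by (intro mult_mono) auto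
      thus "1 \<le> real (M + 1) * real (M + 2)" by simp
    qed (use B a in auto)
    hence "\<bar>bernoulli_poly (M + 2) a\<bar> / (real (M + 1) * real (M + 2)) / z ^ (M + 1) \<le> B / z ^ (M + 1)"
      using z assms by (intro divide_right_mono) auto
    hence 2: "\<bar>(-1) ^ M * bernoulli_poly (M + 2) a / (real (M + 1) * real (M + 2)) / z ^ (M + 1)\<bar>
        \<le> B / z ^ (M + 1)"
      using z assms by (simp add: abs_mult power_abs)
    show "\<bar>ln_Gamma (z + a) - stirling_sum M a z - ln (2 * pi) / 2\<bar> \<le> (2 * C + B) / z ^ (M + 1)"
      using 1 2 unfolding stirling_sum_Suc add_divide_distrib by linarith
  qed
qed

section \<open>The negative binomial mass function\<close>

text \<open>
  With \<open>ln (r/p) = ln r - ln p\<close> and \<open>ln \<mu> = ln r + ln q - ln p\<close>, all terms in \<open>ln r\<close>, \<open>ln p\<close>, \<open>ln q\<close> and the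
  constants \<open>\<onehalf> ln (2\<pi>)\<close> cancel; the factor \<open>\<surd>(2\<pi>\<sigma>^2)\<close> is what balances them. The coefficients of the
  three Stirling series add up to \<open>nb_coeff\<close> because \<open>(r/p)^(-n) = p^n r^(-n)\<close> and \<open>\<mu>^(-n) = (p/q)^n r^(-n)\<close>. So the
  remainder is exactly a combination of three Stirling remainders.\<close>

lemma ln_nb_mass_decomposition:
  assumes r: "r > 0" and p: "0 < p" "p < 1"
    and k: "nb_mean r p + t = real k"
  shows "ln (sqrt (2 * pi * nb_variance r p) * nb_mass r p k) - (\<Sum>n=1..M. nb_coeff n t p / r ^ n) =
      (ln_Gamma (r / p + t) - stirling_sum M t (r / p) - ln (2 * pi) / 2)
    - (ln_Gamma (nb_mean r p + (t + 1)) - stirling_sum M (t + 1) (nb_mean r p) - ln (2 * pi) / 2)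
    - (ln_Gamma (r + 0) - stirling_sum M 0 r - ln (2 * pi) / 2)"
proof -
  define m where "m = nb_mean r p"
  have m: "m > 0" using r p by (simp add: m_def nb_mean_def)
  have rp: "r / p = m + r" using p by (simp add: m_def nb_mean_def field_simps)
  have km: "real k = m + t" using k by (simp add: m_def)
  have ln_rp: "ln (m + r) = ln r - ln p"
    unfolding rp[symmetric] using r p by (simp add: ln_div)
  have ln_m: "ln m = ln r + ln (1 - p) - ln p"
    unfolding m_def nb_mean_def using r p by (simp add: ln_div ln_mult_pos)
  have var: "nb_variance r p > 0" using r p by (simp add: nb_variance_def)
  have mass: "nb_mass r p k > 0"
    unfolding nb_mass_def using r p
    by (intro mult_pos_pos divide_pos_pos Gamma_real_pos) auto
  have Gammas: "Gamma (real k + r) \<noteq> 0" "Gamma r \<noteq> 0" "Gamma (real k + 1) \<noteq> 0"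
    using r by (auto intro!: Gamma_real_pos less_imp_neq[symmetric])
  have "ln (sqrt (2 * pi * nb_variance r p) * nb_mass r p k) =
      (ln (2 * pi) + ln (nb_variance r p)) / 2 + ln (nb_mass r p k)"
    using var mass by (simp add: ln_mult_pos ln_sqrt)
  also have "ln (nb_variance r p) = ln r + ln (1 - p) - 2 * ln p"
    using r p by (simp add: nb_variance_def ln_div ln_mult_pos ln_realpow)
  also have "ln (nb_mass r p k) = ln_Gamma (real k + r) - (ln_Gamma r + ln_Gamma (real k + 1))
      + r * ln p + real k * ln (1 - p)"
    unfolding nb_mass_def using r p Gammas
    by (simp add: ln_mult_pos ln_div ln_realpow ln_powr ln_Gamma_real_pos)
  finally have lhs: "ln (sqrt (2 * pi * nb_variance r p) * nb_mass r p k) =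
      (ln (2 * pi) + (ln r + ln (1 - p) - 2 * ln p)) / 2
      + (ln_Gamma (m + r + t) - (ln_Gamma r + ln_Gamma (m + (t + 1)))
      + r * ln p + (m + t) * ln (1 - p))"
    by (simp add: km add_ac)
  have terms: "nb_coeff n t p / r ^ n =
      (-1) ^ (n + 1) * bernoulli_poly (n + 1) t / (real n * real (n + 1)) / (m + r) ^ n
      - (-1) ^ (n + 1) * bernoulli_poly (n + 1) (t + 1) / (real n * real (n + 1)) / m ^ n
      - (-1) ^ (n + 1) * bernoulli_poly (n + 1) 0 / (real n * real (n + 1)) / r ^ n" for n
  proof -
    have 1: "1 / (m + r) ^ n = p ^ n / r ^ n"
      unfolding rp[symmetric] by (simp add: power_divide)
    have 2: "1 / m ^ n = (p / (1 - p)) ^ n / r ^ n"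
      by (simp add: m_def nb_mean_def power_divide power_mult_distrib)
    have collect: "s / d * (P * x - Q * y - w) / R = s * x / d * (P / R) - s * y / d * (Q / R) - s * w / d * (1 / R)"
      for s d P Q x y w R :: real
      by (simp add: algebra_simps diff_divide_distrib add_divide_distrib)
    show ?thesis
      unfolding nb_coeff_def collect 1[symmetric] 2[symmetric] bernoulli_number_def by simp
  qed
  have "(\<Sum>n=1..M. nb_coeff n t p / r ^ n) =
      (stirling_sum M t (m + r) - ((m + r + t - 1 / 2) * ln (m + r) - (m + r)))
      - (stirling_sum M (t + 1) m - ((m + (t + 1) - 1 / 2) * ln m - m))
      - (stirling_sum M 0 r - ((r - 1 / 2) * ln r - r))"
    unfolding terms sum_subtractf by (simp add: stirling_sum_def)
  thus ?thesis
    unfolding lhs rp m_def[symmetric] ln_rp ln_m by (simp add: field_simps)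
qed

lemma nb_coeff_1:
  assumes "0 < p" "p < 1"
  shows "nb_coeff 1 t p =
    - (p ^ 2 / (2 * (1 - p))) * bernoulli_poly 2 t - p / (1 - p) * t - 1 / 12"
proof -
  have "bernoulli_poly 2 (t + 1) = bernoulli_poly 2 t + 2 * t"
    using bernoulli_poly_diff[of 1 t] by (simp add: numeral_2_eq_2)
  hence "nb_coeff 1 t p = (p * bernoulli_poly 2 t - p / (1 - p) * (bernoulli_poly 2 t + 2 * t) - 1 / 6) / 2"
    by (simp add: nb_coeff_def bernoulli_number_2 flip: numeral_2_eq_2)
  also have "p / (1 - p) = p + p ^ 2 / (1 - p)"
    using assms by (simp add: field_simps power2_eq_square)
  also have "(p * b - (p + u) * (b + 2 * t) - 1 / 6) / 2 = - (u / 2) * b - (p + u) * t - 1 / 12"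
    for b u :: real
    by (simp add: field_simps)
  also have "p + p ^ 2 / (1 - p) = p / (1 - p)"
    using assms by (simp add: field_simps power2_eq_square)
  finally show ?thesis by simp
qed

lemma nb_coeff_2:
  "nb_coeff 2 t p = - (1 / 6) * (p ^ 2 * bernoulli_poly 3 t
     - p ^ 2 / (1 - p) ^ 2 * bernoulli_poly 3 (t + 1))"
  using bernoulli_number_3 by (simp add: nb_coeff_def power_divide)

theorem theorem4p1:
  fixes I H :: "real set"
  assumes "compact I" and "I \<subseteq> {0<..<1}" and "compact H"
  shows "(\<forall>M::nat. \<exists>C R :: real. \<forall>r>0. r \<ge> R \<longrightarrow>
            (\<forall>p\<in>I. \<forall>t\<in>H. \<forall>k::nat. nb_mean r p + t = real k \<longrightarrow>
               \<bar>ln (sqrt (2 * pi * nb_variance r p) * nb_mass r p k)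
                 - (\<Sum>n=1..M. nb_coeff n t p / r ^ n)\<bar> \<le> C / r ^ (M + 1)))
       \<and> (\<forall>p\<in>{0<..<1}. \<forall>t::real.
            nb_coeff 1 t p =
              - (p ^ 2 / (2 * (1 - p))) * bernoulli_poly 2 t - p / (1 - p) * t - 1 / 12
          \<and> nb_coeff 2 t p =
              - (1 / 6) * (p ^ 2 * bernoulli_poly 3 t
                           - p ^ 2 / (1 - p) ^ 2 * bernoulli_poly 3 (t + 1)))"
proof (intro conjI allI ballI)
  fix M :: nat
  (* Each of r, r/p and the mean r(1-p)/p is at least (1-p) r, so a lower bound delta for 1-p makes
     all three arguments large uniformly in p. *)
  obtain \<delta> where \<delta>: "0 < \<delta>" "\<delta> \<le> 1" "\<And>p. p \<in> I \<Longrightarrow> \<delta> \<le> 1 - p"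
  proof (cases "I = {}")
    case False
    then obtain b where b: "b \<in> I" "\<And>p. p \<in> I \<Longrightarrow> p \<le> b"
      using compact_attains_sup[OF assms(1)] by blast
    show thesis by (rule that[of "1 - b"]) (use b assms(2) in force)+
  qed (use that[of 1] in auto)
  obtain A0 where A0: "\<And>t. t \<in> H \<Longrightarrow> \<bar>t\<bar> \<le> A0"
    using compact_imp_bounded[OF assms(3)] by (auto simp: bounded_iff)
  (* A must bound the shift t + 1 of the second Gamma factor as well as t. *)
  define A where "A = \<bar>A0\<bar> + 1"
  have A: "A \<ge> 0" "\<And>t. t \<in> H \<Longrightarrow> \<bar>t\<bar> \<le> A" "\<And>t. t \<in> H \<Longrightarrow> \<bar>t + 1\<bar> \<le> A"
    using A0 by (force simp: A_def)+
  obtain C where C: "\<And>a z. \<bar>a\<bar> \<le> A \<Longrightarrow> z \<ge> 2 * A + 1 \<Longrightarrow>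
      \<bar>ln_Gamma (z + a) - stirling_sum M a z - ln (2 * pi) / 2\<bar> \<le> C / z ^ (M + 1)"
    using ln_Gamma_stirling_bound[OF A(1), of M] by blast
  have "0 \<le> C / (2 * A + 1) ^ (M + 1)" using C[of 0 "2 * A + 1"] A(1) by (smt (verit) abs_ge_zero)
  moreover have "(2 * A + 1) ^ (M + 1) > 0" using A(1) by simp
  ultimately have C0: "C \<ge> 0" by (simp only: zero_le_divide_iff) linarith
  show "\<exists>C R :: real. \<forall>r>0. r \<ge> R \<longrightarrow>
            (\<forall>p\<in>I. \<forall>t\<in>H. \<forall>k::nat. nb_mean r p + t = real k \<longrightarrow>
               \<bar>ln (sqrt (2 * pi * nb_variance r p) * nb_mass r p k)
                 - (\<Sum>n=1..M. nb_coeff n t p / r ^ n)\<bar> \<le> C / r ^ (M + 1))"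
  proof (intro exI allI impI ballI)
    fix r p t :: real and k :: nat
    assume r: "r > 0" "r \<ge> (2 * A + 1) / \<delta>" and pI: "p \<in> I" and t: "t \<in> H"
      and k: "nb_mean r p + t = real k"
    have p: "0 < p" "p < 1" using pI assms(2) by auto
    have big: "\<delta> * r \<ge> 2 * A + 1" using r(2) \<delta>(1) by (simp add: field_simps)
    have err: "\<bar>ln_Gamma (z + a) - stirling_sum M a z - ln (2 * pi) / 2\<bar> \<le> C / (\<delta> * r) ^ (M + 1)"
      if "\<bar>a\<bar> \<le> A" "z \<ge> \<delta> * r" for a z
    proof -
      have pos: "\<delta> * r > 0" using r(1) \<delta>(1) by simp
      have "\<bar>ln_Gamma (z + a) - stirling_sum M a z - ln (2 * pi) / 2\<bar> \<le> C / z ^ (M + 1)"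
        using that big by (intro C) auto
      also have "C / z ^ (M + 1) \<le> C / (\<delta> * r) ^ (M + 1)"
        using that pos r(1) \<delta>(1) C0 by (intro divide_left_mono power_mono mult_pos_pos zero_less_power) linarith+
      finally show ?thesis .
    qed
    have zero: "\<bar>0 :: real\<bar> \<le> A" using A(1) by simp
    have "\<delta> * r \<le> 1 * r" using \<delta> r by (intro mult_right_mono) auto
    hence z3: "r \<ge> \<delta> * r" by simp
    have "r * 1 \<le> r * (1 / p)" using r p by (intro mult_left_mono) auto
    hence z1: "r / p \<ge> \<delta> * r" using z3 by simp
    have "\<delta> * r * 1 \<le> ((1 - p) * r) * (1 / p)"
      using \<delta>(3)[OF pI] \<delta>(1) r p by (intro mult_mono) auto
    hence z2: "nb_mean r p \<ge> \<delta> * r" by (simp add: nb_mean_def mult_ac)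
    have "\<bar>ln (sqrt (2 * pi * nb_variance r p) * nb_mass r p k)
         - (\<Sum>n=1..M. nb_coeff n t p / r ^ n)\<bar> \<le> 3 * (C / (\<delta> * r) ^ (M + 1))"
      unfolding ln_nb_mass_decomposition[OF r(1) p k, of M]
      using err[OF A(2)[OF t] z1] err[OF A(3)[OF t] z2] err[OF zero z3] by linarith
    also have "\<dots> = 3 * C / \<delta> ^ (M + 1) / r ^ (M + 1)"
      by (simp add: power_mult_distrib)
    finally show "\<bar>ln (sqrt (2 * pi * nb_variance r p) * nb_mass r p k)
         - (\<Sum>n=1..M. nb_coeff n t p / r ^ n)\<bar> \<le> 3 * C / \<delta> ^ (M + 1) / r ^ (M + 1)" .
  qed
qed (use nb_coeff_1 nb_coeff_2 in auto)

end
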